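(* Let $C\subseteq\mathbb{F}_q^n$ be an $[n,k]$ code over $\mathbb{F}_q$ and let $T\subseteq[n]$. Then for any integer $r$ with $0\le r\le k$, $$J_{C,T}^{(r)}(w,z,x,y)=\frac{1}{[r]_q}\sum_{j=0}^{r}\genfrac{[}{]}{0pt}{}{r}{j}_q(-1)^{r-j}q^{\binom{r-j}{2}}\,J_{C,T}(w,z,x,y;q^j).$$
   Context: $q$ is a prime power, $[n]=\{1,\dots,n\}$, and $\overline{T}=[n]\setminus T$. An $[n,k]$ code over $\mathbb{F}_q$ is a $k$-dimensional $\mathbb{F}_q$-linear subspace of $\mathbb{F}_q^n$. For a positive integer $m$, the extension code $C[q^m]=C\otimes\mathbb{F}_{q^m}\subseteq\mathbb{F}_{q^m}^n$ is the set of all $\mathbb{F}_{q^m}$-linear combinations of codewords of $C$. For a vector $u$ and $S\subseteq[n]$, $\mathrm{wt}_S(u)=\#\{i\in S : u_i\ne0\}$. For a linear subspace $D\subseteq\mathbb{F}_q^n$, $\mathrm{Supp}(D)=\{i\in[n] : u_i\ne 0\text{ for some }u\in D\}$ and $\mathrm{wt}_S(D)=|\mathrm{Supp}(D)\cap S|$. $\mathcal{D}_r(C)$ is the set of $r$-dimensional $\mathbb{F}_q$-subspaces of $C$. The $r$-th higher Jacobi polynomial is $$J_{C,T}^{(r)}(w,z,x,y)=\sum_{i=0}^{n-|T|}\sum_{j=0}^{|T|}A_{i,j}^{(r)}(C;T)\,w^{|T|-j}z^{j}x^{n-|T|-i}y^{i},$$ with $A_{i,j}^{(r)}(C;T)=\#\{D\in\mathcal{D}_r(C)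 : \mathrm{wt}_{\overline{T}}(D)=i,\ \mathrm{wt}_T(D)=j\}$. For $m\ge1$ the $q^m$-extended Jacobi polynomial is $$J_{C,T}(w,z,x,y;q^m)=\sum_{i=0}^{n-|T|}\sum_{j=0}^{|T|}A_{i,j}^{q^m}(C;T)\,w^{|T|-j}z^{j}x^{n-|T|-i}y^{i},$$ with $A_{i,j}^{q^m}(C;T)=\#\{u\in C[q^m] : \mathrm{wt}_{\overline{T}}(u)=i,\ \mathrm{wt}_T(u)=j\}$. For exponent $m=0$ the convention is $J_{C,T}(w,z,x,y;q^0)=w^{|T|}x^{n-|T|}$ (only the zero codeword contributes). For integers $a,b\ge0$: $[a,b]_q=\prod_{i=0}^{b-1}(q^a-q^i)$, $[a]_q=[a,a]_q$ (so $[0]_q=1$), and $\genfrac{[}{]}{0pt}{}{a}{b}_q=[a,b]_q/[b]_q$ is the Gaussian binomial coefficient. *)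

theory Defs
  imports
    "HOL-Analysis.Analysis"
    "HOL-Algebra.Algebraic_Closure_Type"
    "HOL-Library.Poly_Mapping"
begin

text \<open>
  The ground field is a type \<open>'a\<close> of class \<^class>\<open>finite_field\<close>, so that \<open>q = CARD('a)\<close>. Words of
  length \<open>n = CARD('n)\<close> have type \<open>'a^'n\<close>, with the index type \<open>'n\<close> in the role of \<open>[n]\<close>; the
  complement of \<open>T\<close> in \<open>[n]\<close> is \<open>- T\<close>.
\<close>


section \<open>Gaussian binomial coefficients\<close>

definition q_falling :: "nat \<Rightarrow> nat \<Rightarrow> nat \<Rightarrow> rat" where
  "q_falling q a b = (\<Prod>i<b. of_nat q ^ a - of_nat q ^ i)"

definition q_binomial :: "nat \<Rightarrow> nat \<Rightarrow> nat \<Rightarrow> rat" where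
  "q_binomial q a b = q_falling q a b / q_falling q b b"


section \<open>The fields of order \<open>q ^ m\<close> and extension codes\<close>

text \<open>
  All the fields of order \<open>q ^ m\<close> with \<open>m \<ge> 1\<close> are taken inside one algebraic closure of the ground
  field, as the set of roots of \<open>X ^ q ^ m - X\<close>; the lemmas below confirm that this is a subfield of
  that order which contains the ground field. For \<open>m = 0\<close> the set is meaningless, as \<open>X - X = 0\<close>.
\<close>

definition GF_ext :: "nat \<Rightarrow> 'a::finite_field alg_closure set" where
  "GF_ext m = {x. x ^ (CARD('a) ^ m) = x}"

lemma finite_field_binomial_eq_0:
  assumes "0 < i" "i < CARD('a)"
  shows "of_nat (CARD('a) choose i) = (0 :: 'a::finite_field)"
proof -
  define q where "q = CARD('a)"
  define g :: "'a poly" where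
    "g = (\<Sum>i\<in>{0<..<q}. Polynomial.monom (of_nat (q choose i)) i)"
  have q: "q > 1"
    using assms unfolding q_def by linarith
  have "poly g x = 0" for x
  proof -
    have "x + 1 = (x + 1) ^ q"
      unfolding q_def by (simp add: finite_field_power_card_eq_same)
    also have "\<dots> = (\<Sum>i\<le>q. of_nat (q choose i) * x ^ i)"
      by (simp add: binomial_ring)
    also have "{..q} = insert 0 (insert q {0<..<q})"
      by auto
    also have "(\<Sum>i\<in>\<dots>. of_nat (q choose i) * x ^ i) =
        1 + x ^ q + (\<Sum>i\<in>{0<..<q}. of_nat (q choose i) * x ^ i)"
      using q by simp
    also have "x ^ q = x"
      unfolding q_def by (simp add: finite_field_power_card_eq_same)
    finally show ?thesis
      unfolding g_def by (simp add: poly_sum poly_monom)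
  qed
  then have roots: "card {x. poly g x = 0} = q"
    unfolding q_def by simp
  have "Polynomial.degree g \<le> q - 1"
    unfolding g_def by (intro degree_sum_le) (auto intro!: order.trans[OF degree_monom_le])
  then have "Polynomial.degree g < q"
    using q by linarith
  then have "g = 0"
    using card_poly_roots_bound[of g] roots by linarith
  moreover have "Polynomial.coeff g i = of_nat (q choose i)"
    using assms unfolding g_def q_def by (simp add: coeff_sum)
  ultimately show ?thesis
    unfolding q_def by simp
qed

lemma GF_ext_power_add:
  "(x + y) ^ (CARD('a) ^ m) = x ^ (CARD('a) ^ m) + y ^ (CARD('a) ^ m)"
  for x y :: "'a::finite_field alg_closure"
proof (induction m)
  case (Suc m)
  define q where "q = CARD('a)"
  have q: "q > 0"
    unfolding q_def by simp
  have zero: "of_nat (q choose i) = (0 :: 'a alg_closure)" if "0 < i" "i < q" for i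
    using finite_field_binomial_eq_0[where ?'a = 'a] that unfolding q_def
    by (metis to_ac_0 to_ac_of_nat)
  have "(u + v) ^ q = u ^ q + v ^ q" for u v :: "'a alg_closure"
  proof -
    have "(u + v) ^ q = (\<Sum>i\<le>q. of_nat (q choose i) * u ^ i * v ^ (q - i))"
      by (rule binomial_ring)
    also have "\<dots> = (\<Sum>i\<in>{0, q}. of_nat (q choose i) * u ^ i * v ^ (q - i))"
      by (intro sum.mono_neutral_right) (auto simp: zero)
    finally show ?thesis
      using q by simp
  qed
  then show ?case
    using Suc unfolding q_def by (simp add: power_mult mult.commute[of "CARD('a)"])
qed auto

lemma to_ac_in_GF_ext: "to_ac c \<in> GF_ext m"
  unfolding GF_ext_def
  by (simp add: finite_field_power_card_power_eq_same[OF refl] flip: to_ac_power)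

lemma GF_ext_add: "x \<in> GF_ext m \<Longrightarrow> y \<in> GF_ext m \<Longrightarrow> x + y \<in> GF_ext m"
  unfolding GF_ext_def by (simp add: GF_ext_power_add)

lemma GF_ext_mult: "x \<in> GF_ext m \<Longrightarrow> y \<in> GF_ext m \<Longrightarrow> x * y \<in> GF_ext m"
  unfolding GF_ext_def by (simp add: power_mult_distrib)

lemma GF_ext_uminus: "x \<in> GF_ext m \<Longrightarrow> - x \<in> GF_ext m"
  using GF_ext_mult[of "to_ac (- 1)" m x] to_ac_in_GF_ext[of "- 1" m] by simp

lemma GF_ext_inverse: "x \<in> GF_ext m \<Longrightarrow> inverse x \<in> GF_ext m"
  unfolding GF_ext_def by (simp add: power_inverse)

lemma card_GF_ext:
  assumes "m > 0"
  shows "card (GF_ext m :: 'a::finite_field alg_closure set) = CARD('a) ^ m"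
proof -
  define N where "N = CARD('a) ^ m"
  define p :: "'a alg_closure poly" where "p = Polynomial.monom 1 N - [:0, 1:]"
  have q: "CARD('a) > 1"
    using card_mono[of UNIV "{0, 1 :: 'a}"] by simp
  then have N: "N > 1"
    using assms unfolding N_def by (intro one_less_power)
  have "of_nat CARD('a) = (0 :: 'a)"
    using finite_field_binomial_eq_0[where ?'a = 'a, of 1] q by simp
  then have "of_nat CARD('a) = (0 :: 'a alg_closure)"
    by (metis to_ac_0 to_ac_of_nat)
  then have N0: "of_nat N = (0 :: 'a alg_closure)"
    using assms unfolding N_def by simp
  have deg: "Polynomial.degree p = N"
    using N unfolding p_def diff_conv_add_uminus
    by (subst degree_add_eq_left) (auto simp: degree_monom_eq)
  have p0: "p \<noteq> 0"
    using deg N by auto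
  have deriv: "pderiv p = [:- 1:]"
    using N N0 unfolding p_def by (simp add: pderiv_diff pderiv_monom pderiv_pCons)
  have simple: "Polynomial.order x p < 2" for x
  proof (rule ccontr)
    assume "\<not> Polynomial.order x p < 2"
    then have "[:- x, 1:] ^ 2 dvd p"
      by (simp add: order_divides)
    then obtain r where "p = [:- x, 1:] * ([:- x, 1:] * r)"
      unfolding power2_eq_square mult.assoc dvd_def by blast
    then have "poly (pderiv p) x = 0"
      by (simp add: pderiv_mult del: mult_pCons_left)
    then show False
      unfolding deriv by simp
  qed
  have roots: "{x. poly p x = 0} = GF_ext m"
    unfolding p_def GF_ext_def N_def by (auto simp: poly_monom)
  obtain M where M: "size M = Polynomial.degree p"
      "p = Polynomial.smult (Polynomial.lead_coeff p) (\<Prod>x\<in>#M. [:-x, 1:])"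
    using alg_closed_imp_factorization[OF p0] by blast
  have "proots (\<Prod>x\<in>#M. [:-x, 1:]) = M"
  proof (induction M)
    case (add y M)
    have "(\<Prod>z\<in>#M. [:-z, 1:]) \<noteq> (0 :: 'a alg_closure poly)"
      by (auto simp: prod_mset_zero_iff)
    then show ?case
      using add by (simp add: proots_mult del: mult_pCons_left)
  qed auto
  then have pM: "proots p = M"
    using p0 by (subst M(2)) simp
  have "count M x = 1" if "x \<in># M" for x
    using that simple[of x] count_proots[OF p0, of x] unfolding pM
    by (metis One_nat_def count_greater_zero_iff less_2_cases less_irrefl)
  then have "size M = card (set_mset M)"
    unfolding size_multiset_overloaded_eq by simp
  moreover have "set_mset M = GF_ext m"
    using set_count_proots[OF p0] roots pM by simp
  ultimately show ?thesis
    using M(1) deg N_def by simp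
qed

definition extension_code ::
    "nat \<Rightarrow> ('a::finite_field ^ 'n) set \<Rightarrow> ('a alg_closure ^ 'n) set" where
  "extension_code m C =
     {\<Sum>c\<in>C. a c *s (\<chi> i. to_ac (c $ i)) | a. \<forall>c\<in>C. a c \<in> GF_ext m}"


section \<open>Supports and weights\<close>

definition wt :: "'n set \<Rightarrow> 'b::zero ^ 'n \<Rightarrow> nat" where
  "wt S u = card {i \<in> S. u $ i \<noteq> 0}"

definition Supp :: "('b::zero ^ 'n) set \<Rightarrow> 'n set" where
  "Supp D = {i. \<exists>u\<in>D. u $ i \<noteq> 0}"

definition wt_space :: "'n set \<Rightarrow> ('b::zero ^ 'n) set \<Rightarrow> nat" where
  "wt_space S D = card (Supp D \<inter> S)"

definition subcodes :: "nat \<Rightarrow> ('a::field ^ 'n) set \<Rightarrow> ('a ^ 'n) set set" where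
  "subcodes r C = {D. vec.subspace D \<and> D \<subseteq> C \<and> vec.dim D = r}"


section \<open>Jacobi polynomials\<close>

text \<open>
  The polynomial ring in the four variables \<open>w, z, x, y\<close> over the rationals: the monoid algebra of
  the free commutative monoid on the four variables.
\<close>

datatype jvar = var_w | var_z | var_x | var_y

type_synonym jpoly = "(jvar \<Rightarrow>\<^sub>0 nat) \<Rightarrow>\<^sub>0 rat"

definition Var :: "jvar \<Rightarrow> jpoly" where
  "Var v = Poly_Mapping.single (Poly_Mapping.single v 1) 1"

definition Const :: "rat \<Rightarrow> jpoly" where
  "Const c = Poly_Mapping.single 0 c"

definition A_higher :: "nat \<Rightarrow> ('a::finite_field ^ 'n) set \<Rightarrow> 'n set \<Rightarrow> nat \<Rightarrow> nat \<Rightarrow> nat" where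
  "A_higher r C T i j = card {D \<in> subcodes r C. wt_space (- T) D = i \<and> wt_space T D = j}"

definition A_ext :: "nat \<Rightarrow> ('a::finite_field ^ 'n) set \<Rightarrow> 'n set \<Rightarrow> nat \<Rightarrow> nat \<Rightarrow> nat" where
  "A_ext m C T i j = card {u \<in> extension_code m C. wt (- T) u = i \<and> wt T u = j}"

definition higher_jacobi :: "nat \<Rightarrow> ('a::finite_field ^ 'n) set \<Rightarrow> 'n set \<Rightarrow> jpoly" where
  "higher_jacobi r C T =
     (\<Sum>i = 0..CARD('n) - card T. \<Sum>j = 0..card T. of_nat (A_higher r C T i j) *
        Var var_w ^ (card T - j) * Var var_z ^ j * Var var_x ^ (CARD('n) - card T - i) * Var var_y ^ i)"

text \<open>The polynomial \<open>J(w,z,x,y; q ^ m)\<close> is indexed by the exponent \<open>m\<close>.\<close>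

definition ext_jacobi :: "nat \<Rightarrow> ('a::finite_field ^ 'n) set \<Rightarrow> 'n set \<Rightarrow> jpoly" where
  "ext_jacobi m C T =
     (if m = 0 then Var var_w ^ card T * Var var_x ^ (CARD('n) - card T)
      else \<Sum>i = 0..CARD('n) - card T. \<Sum>j = 0..card T. of_nat (A_ext m C T i j) *
        Var var_w ^ (card T - j) * Var var_z ^ j * Var var_x ^ (CARD('n) - card T - i) * Var var_y ^ i)"

end

theory Submission
  imports Defs
begin

text \<open>
  Write \<open>q = CARD('a)\<close>. To a word \<open>u\<close> over the field of order \<open>q ^ m\<close> belongs a code over the ground
  field: expand the entries of \<open>u\<close> over a basis of the extension field and take the span
  \<open>coord_space u\<close> of the coordinate words. This code has three properties.

  \<^item> It has the same support as \<open>u\<close>, hence the same weights on \<open>T\<close> and on \<open>- T\<close>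
    (\<open>wt_space_coord_space\<close>).
  \<^item> The word \<open>u\<close> lies in the extension of a code \<open>C\<close> iff \<open>coord_space u \<subseteq> C\<close>
    (\<open>coord_space_subset\<close>, \<open>in_extension_code_coord_space\<close>).
  \<^item> A code \<open>D\<close> of dimension \<open>s\<close> equals \<open>coord_space u\<close> for exactly
    \<open>q_falling q m s = (q ^ m - 1) (q ^ m - q) \<dots> (q ^ m - q ^ (s - 1))\<close> words \<open>u\<close>: these are the
    combinations of a basis of \<open>D\<close> with coefficients that are linearly independent over the ground
    field (\<open>card_coord_space_eq\<close>).

  Sorting the words of the extension code by \<open>coord_space\<close> therefore expresses the extended Jacobi
  polynomials by the higher ones: the polynomial for exponent \<open>m\<close> is the sum over \<open>s \<le> m\<close> of
  \<open>q_falling q m s\<close> times the \<open>s\<close>-th higher Jacobi polynomial (\<open>ext_jacobi_eq_sum_higher_jacobi\<close>).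

  The theorem inverts this triangular system. The required orthogonality relation
  \<open>q_Cauchy_coeff_orthogonal\<close> follows from the Cauchy binomial theorem.
\<close>


section \<open>Inverting sums of falling \<open>q\<close>-factorials\<close>

lemma q_falling_0 [simp]: "q_falling q a 0 = 1"
  by (simp add: q_falling_def)

lemma q_falling_Suc: "q_falling q a (Suc b) = q_falling q a b * (of_nat q ^ a - of_nat q ^ b)"
  by (simp add: q_falling_def)

lemma q_falling_eq_0: "a < b \<Longrightarrow> q_falling q a b = 0"
  by (auto simp: q_falling_def)

lemma q_falling_nonzero:
  assumes "2 \<le> q" "b \<le> a"
  shows "q_falling q a b \<noteq> 0"
  using assms by (simp add: q_falling_def)

text \<open>Taking a factor \<open>q\<close> out of each \<open>q ^ Suc a - q ^ Suc i\<close> leaves the factor for \<open>i = 0\<close>.\<close>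

lemma q_falling_Suc_Suc:
  "q_falling q (Suc a) (Suc b) = (of_nat q ^ Suc a - 1) * of_nat q ^ b * q_falling q a b"
proof (induction b)
  case (Suc b)
  have "q_falling q (Suc a) (Suc (Suc b)) =
      (of_nat q ^ Suc a - 1) * of_nat q ^ b * q_falling q a b * (of_nat q ^ Suc a - of_nat q ^ Suc b)"
    by (subst q_falling_Suc, subst Suc) simp
  then show ?case
    by (simp add: q_falling_Suc algebra_simps)
qed (simp add: q_falling_Suc)

lemma q_binomial_0 [simp]: "q_binomial q a 0 = 1"
  by (simp add: q_binomial_def)

lemma q_binomial_eq_0: "a < b \<Longrightarrow> q_binomial q a b = 0"
  by (simp add: q_binomial_def q_falling_eq_0)

lemma q_binomial_Pascal:
  assumes "2 \<le> q"
  shows "q_binomial q (Suc a) (Suc b) = q_binomial q a b + of_nat q ^ Suc b * q_binomial q a (Suc b)"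
proof -
  define x y z where "x = (of_nat q ^ Suc b - 1 :: rat)" and "y = (of_nat q ^ b :: rat)"
    and "z = q_falling q b b"
  have "(1 :: rat) < of_nat q ^ Suc b"
    using assms by (intro one_less_power) auto
  then have nz: "x \<noteq> 0" "y \<noteq> 0" "z \<noteq> 0"
    using assms q_falling_nonzero[of q b b] by (auto simp: x_def y_def z_def)
  have den: "q_falling q (Suc b) (Suc b) = x * y * z"
    by (simp add: q_falling_Suc_Suc x_def y_def z_def)
  have "q_binomial q (Suc a) (Suc b) = q_falling q a b * (of_nat q ^ Suc a - 1) / (x * z)"
    using nz unfolding q_binomial_def den by (simp add: q_falling_Suc_Suc y_def field_simps)
  also have "of_nat q ^ Suc a - 1 = x + of_nat q * (of_nat q ^ a - y)"
    by (simp add: x_def y_def algebra_simps)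
  also have "q_falling q a b * (x + of_nat q * (of_nat q ^ a - y)) / (x * z) =
      q_falling q a b / z + of_nat q * y * (q_falling q a b * (of_nat q ^ a - y) / (x * y * z))"
    using nz by (simp add: divide_simps) (simp add: algebra_simps)
  finally show ?thesis
    unfolding q_binomial_def den by (simp add: q_falling_Suc y_def z_def)
qed

text \<open>
  The coefficients of the inversion formula are those of \<open>\<Prod>i<r. (t - q ^ i)\<close>, so that \<open>q_Cauchy\<close>
  below is the Cauchy binomial theorem.
\<close>

definition q_Cauchy_coeff :: "nat \<Rightarrow> nat \<Rightarrow> nat \<Rightarrow> rat" where
  "q_Cauchy_coeff q r j = q_binomial q r j * (-1) ^ (r - j) * of_nat q ^ ((r - j) choose 2)"

lemma choose_two_Suc: "Suc n choose 2 = (n choose 2) + n"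
  by (simp add: numeral_2_eq_2)

lemma q_Cauchy_coeff_Suc_0: "q_Cauchy_coeff q (Suc r) 0 = - (of_nat q ^ r * q_Cauchy_coeff q r 0)"
  by (simp add: q_Cauchy_coeff_def choose_two_Suc power_add)

text \<open>
  This is multiplication by \<open>t - q ^ r\<close> on coefficients: \<open>q ^ r\<close> is the factor \<open>q ^ Suc j\<close> of the
  Pascal rule times the growth \<open>q ^ (r - Suc j)\<close> of the power with exponent \<open>(r - Suc j) choose 2\<close>.
\<close>

lemma q_Cauchy_coeff_Suc_Suc:
  assumes "2 \<le> q" "j \<le> r"
  shows "q_Cauchy_coeff q (Suc r) (Suc j) = q_Cauchy_coeff q r j - of_nat q ^ r * q_Cauchy_coeff q r (Suc j)"
proof (cases "j = r")
  case True
  then show ?thesis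
    using q_binomial_Pascal[OF assms(1), of r r] by (simp add: q_Cauchy_coeff_def q_binomial_eq_0)
next
  case False
  then obtain l where l: "r = Suc (j + l)"
    using assms by (metis add_Suc_right le_neq_implies_less less_iff_Suc_add)
  then show ?thesis
    using q_binomial_Pascal[OF assms(1), of r j]
    by (simp add: q_Cauchy_coeff_def choose_two_Suc power_add algebra_simps)
qed

lemma q_Cauchy:
  assumes "2 \<le> q"
  shows "(\<Sum>j\<le>r. q_Cauchy_coeff q r j * t ^ j) = (\<Prod>i<r. t - of_nat q ^ i)"
proof (induction r)
  case (Suc r)
  let ?c = "q_Cauchy_coeff q"
  let ?S = "\<Sum>j\<le>r. ?c r j * t ^ j"
  have "(\<Sum>j\<le>Suc r. ?c (Suc r) j * t ^ j) =
      ?c (Suc r) 0 + (\<Sum>j\<le>r. ?c (Suc r) (Suc j) * t ^ Suc j)"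
    by (simp only: sum.atMost_Suc_shift power_0 mult_1_right)
  also have "\<dots> = - (of_nat q ^ r * ?c r 0) +
      (\<Sum>j\<le>r. ?c r j * t ^ Suc j - of_nat q ^ r * (?c r (Suc j) * t ^ Suc j))"
    using assms by (simp add: q_Cauchy_coeff_Suc_0 q_Cauchy_coeff_Suc_Suc algebra_simps)
  also have "\<dots> = t * ?S - of_nat q ^ r * (?c r 0 * t ^ 0 + (\<Sum>j\<le>r. ?c r (Suc j) * t ^ Suc j))"
    by (simp add: sum_subtractf sum_distrib_left algebra_simps)
  also have "?c r 0 * t ^ 0 + (\<Sum>j\<le>r. ?c r (Suc j) * t ^ Suc j) = (\<Sum>j\<le>Suc r. ?c r j * t ^ j)"
    by (simp only: sum.atMost_Suc_shift)
  also have "\<dots> = ?S"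
    by (simp add: q_Cauchy_coeff_def q_binomial_eq_0)
  finally show ?case
    using Suc by (simp add: algebra_simps)
qed (simp add: q_Cauchy_coeff_def binomial_eq_0)

text \<open>
  As a function of \<open>X = q ^ j\<close>, the number \<open>q_falling q j s\<close> is a monic polynomial of degree \<open>s\<close>.
  By \<open>q_Cauchy\<close>, the functional \<open>p \<mapsto> \<Sum>j\<le>r. q_Cauchy_coeff q r j * p (q ^ j)\<close> sends \<open>X ^ d\<close> to
  \<open>q_falling q d r\<close>, which vanishes for \<open>d < r\<close>; hence only the leading term of a polynomial of
  degree at most \<open>r\<close> survives.
\<close>

lemma q_Cauchy_coeff_orthogonal:
  assumes "2 \<le> q"
  shows "(\<Sum>j\<le>r. q_Cauchy_coeff q r j * q_falling q j s) = (if s = r then q_falling q r r else 0)"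
proof (cases "s \<le> r")
  case False
  then show ?thesis
    by (auto intro!: sum.neutral simp: q_falling_eq_0)
next
  case True
  define p :: "rat poly" where "p = (\<Prod>i<s. [:- (of_nat q ^ i), 1:])"
  have deg: "Polynomial.degree p = s"
    unfolding p_def by (subst degree_prod_eq_sum_degree) auto
  have lead: "Polynomial.coeff p s = 1"
    using lead_coeff_prod[of "\<lambda>i. [:- (of_nat q ^ i), 1 :: rat:]" "{..<s}"] deg by (simp add: p_def)
  have falling: "q_falling q j s = (\<Sum>d\<le>s. Polynomial.coeff p d * of_nat q ^ (j * d))" for j
  proof -
    have "q_falling q j s = poly p (of_nat q ^ j)"
      by (simp add: q_falling_def p_def poly_prod)
    then show ?thesis
      by (simp add: poly_altdef deg power_mult)
  qed
  have moment: "(\<Sum>j\<le>r. q_Cauchy_coeff q r j * of_nat q ^ (j * d)) = q_falling q d r" for d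
    using q_Cauchy[OF assms, of r "of_nat q ^ d"]
    by (simp add: q_falling_def mult.commute flip: power_mult)
  have "(\<Sum>j\<le>r. q_Cauchy_coeff q r j * q_falling q j s) =
      (\<Sum>j\<le>r. \<Sum>d\<le>s. Polynomial.coeff p d * (q_Cauchy_coeff q r j * of_nat q ^ (j * d)))"
    by (simp add: falling sum_distrib_left mult_ac)
  also have "\<dots> = (\<Sum>d\<le>s. Polynomial.coeff p d * q_falling q d r)"
    by (subst sum.swap) (simp add: moment flip: sum_distrib_left)
  also have "\<dots> = (\<Sum>d\<in>{s}. Polynomial.coeff p d * q_falling q d r)"
    using True by (intro sum.mono_neutral_right) (auto simp: q_falling_eq_0)
  finally show ?thesis
    using True lead by (auto simp: q_falling_eq_0)
qed


section \<open>Independent families in the extension field\<close>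

text \<open>
  The algebraic closure as a vector space over the ground field: each \<open>GF_ext m\<close> is a subspace, so
  one space of functionals serves all exponents.
\<close>

definition ac_scale :: "'a::finite_field \<Rightarrow> 'a alg_closure \<Rightarrow> 'a alg_closure" where
  "ac_scale c x = to_ac c * x"

interpretation ac: vector_space ac_scale
  by unfold_locales (auto simp: ac_scale_def algebra_simps)

interpretation ac_functional: vector_space_pair ac_scale "(*) :: 'a::finite_field \<Rightarrow> 'a \<Rightarrow> 'a"
  by unfold_locales

abbreviation ac_linear :: "('a::finite_field alg_closure \<Rightarrow> 'a) \<Rightarrow> bool" where
  "ac_linear \<equiv> Vector_Spaces.linear ac_scale (*)"

text \<open>Each step from \<open>S\<close> to \<open>insert x S\<close> writes the span as a disjoint union of \<open>q\<close> translates.\<close>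

lemma card_ac_span:
  assumes "finite S" "ac.independent S"
  shows "card (ac.span S) = CARD('a) ^ card (S :: 'a::finite_field alg_closure set)"
  using assms
proof (induction S)
  case (insert x S)
  have x: "x \<notin> ac.span S" and S: "ac.independent S"
    using insert.prems insert.hyps ac.independent_insert[of x S] by auto
  let ?f = "\<lambda>(c, v). ac_scale c x + v"
  have "inj_on ?f (UNIV \<times> ac.span S)"
  proof (rule inj_onI, clarify)
    fix c c' v v'
    assume v: "v \<in> ac.span S" "v' \<in> ac.span S" and eq: "ac_scale c x + v = ac_scale c' x + v'"
    have "ac_scale (c - c') x = v' - v"
      using eq by (simp add: ac.scale_left_diff_distrib algebra_simps)
    then have mem: "ac_scale (c - c') x \<in> ac.span S"
      using v ac.span_diff by simp
    have "c = c'"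
    proof (rule ccontr)
      assume "c \<noteq> c'"
      then have "x = ac_scale (inverse (c - c')) (ac_scale (c - c') x)"
        by (simp add: ac.scale_scale)
      also have "\<dots> \<in> ac.span S"
        using mem by (rule ac.span_scale)
      finally show False
        using x by simp
    qed
    then show "c = c' \<and> v = v'"
      using eq by simp
  qed
  moreover have "?f ` (UNIV \<times> ac.span S) = ac.span (insert x S)"
  proof -
    have "v \<in> ?f ` (UNIV \<times> ac.span S) \<longleftrightarrow> (\<exists>c. v - ac_scale c x \<in> ac.span S)" for v
    proof
      assume "\<exists>c. v - ac_scale c x \<in> ac.span S"
      then obtain c where "v - ac_scale c x \<in> ac.span S" ..
      then show "v \<in> ?f ` (UNIV \<times> ac.span S)"
        by (intro image_eqI[of _ _ "(c, v - ac_scale c x)"]) auto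
    next
      assume "v \<in> ?f ` (UNIV \<times> ac.span S)"
      then obtain c w where "v = ac_scale c x + w" "w \<in> ac.span S"
        by auto
      then show "\<exists>c. v - ac_scale c x \<in> ac.span S"
        by (intro exI[of _ c]) simp
    qed
    then show ?thesis
      unfolding ac.span_insert by (simp only: set_eq_iff mem_Collect_eq simp_thms)
  qed
  ultimately have "card (ac.span (insert x S)) = CARD('a) * card (ac.span S)"
    using card_image[of ?f "UNIV \<times> ac.span S"] by (simp add: card_cartesian_product)
  then show ?case
    using insert S by simp
qed auto

lemma GF_ext_subspace: "ac.subspace (GF_ext m)"
  by (rule ac.subspaceI)
    (use to_ac_in_GF_ext[of 0 m] in \<open>auto simp: ac_scale_def GF_ext_add GF_ext_mult to_ac_in_GF_ext\<close>)

lemma finite_GF_ext: "0 < m \<Longrightarrow> finite (GF_ext m :: 'a::finite_field alg_closure set)"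
  by (rule card_ge_0_finite) (simp add: card_GF_ext)

text \<open>
  Families rather than sets are counted, since they serve as coefficients; their values outside
  the index set are fixed so that distinct functions are distinct families.
\<close>

definition independent_families :: "nat \<Rightarrow> 'i set \<Rightarrow> ('i \<Rightarrow> 'a::finite_field alg_closure) set" where
  "independent_families m B = {f \<in> B \<rightarrow>\<^sub>E GF_ext m. inj_on f B \<and> ac.independent (f ` B)}"

text \<open>
  A family on \<open>insert b B\<close> is independent iff its restriction to \<open>B\<close> is and its value at \<open>b\<close> avoids
  the span of the others, which has \<open>q ^ card B\<close> of the \<open>q ^ m\<close> elements of the field.
\<close>

lemma card_independent_families:
  assumes "finite B" "0 < m"
  shows "of_nat (card (independent_families m B :: ('i \<Rightarrow> 'a::finite_field alg_closure) set)) =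
    q_falling CARD('a) m (card B)"
  using assms(1)
proof (induction B)
  case empty
  then show ?case
    by (simp add: independent_families_def ac.independent_empty)
next
  case (insert b B)
  let ?I = "independent_families m :: 'i set \<Rightarrow> ('i \<Rightarrow> 'a alg_closure) set"
  let ?new = "\<lambda>f. GF_ext m - ac.span (f ` B)"
  have fin: "finite (?I B)"
    unfolding independent_families_def using insert.hyps finite_GF_ext[OF assms(2)]
    by (intro finite_subset[OF _ finite_PiE[of B "\<lambda>_. GF_ext m"]]) auto
  have new: "of_nat (card (?new f)) = (of_nat CARD('a) ^ m - of_nat CARD('a) ^ card B :: rat)"
    if "f \<in> ?I B" for f
  proof -
    have f: "f ` B \<subseteq> GF_ext m" "inj_on f B" "ac.independent (f ` B)"
      using that by (auto simp: independent_families_def)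
    have sub: "ac.span (f ` B) \<subseteq> GF_ext m"
      using f(1) GF_ext_subspace by (rule ac.span_minimal)
    have "card (ac.span (f ` B)) = CARD('a) ^ card B"
      using insert.hyps f by (simp add: card_ac_span card_image)
    moreover have "card (?new f) = card (GF_ext m :: 'a alg_closure set) - card (ac.span (f ` B))"
      using sub finite_GF_ext[OF assms(2)] by (meson card_Diff_subset finite_subset)
    moreover have "card (ac.span (f ` B)) \<le> card (GF_ext m :: 'a alg_closure set)"
      using sub finite_GF_ext[OF assms(2)] by (intro card_mono)
    ultimately show ?thesis
      by (simp add: card_GF_ext[OF assms(2)] of_nat_diff)
  qed
  let ?ext = "\<lambda>(f, x). f(b := x)"
  have "inj_on ?ext (Sigma (?I B) ?new)"
  proof (rule inj_onI, clarify)
    fix f x g y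
    assume fg: "f \<in> ?I B" "g \<in> ?I B" and eq: "f(b := x) = g(b := y)"
    have "f i = g i" for i
      using fg fun_cong[OF eq, of i] insert.hyps
      by (cases "i = b") (auto simp: independent_families_def PiE_def extensional_def)
    then show "f = g \<and> x = y"
      using fun_cong[OF eq, of b] by auto
  qed
  moreover have "?ext ` Sigma (?I B) ?new = ?I (insert b B)"
  proof (intro equalityI subsetI)
    fix g
    assume "g \<in> ?ext ` Sigma (?I B) ?new"
    then obtain f x where f: "f \<in> ?I B" and x: "x \<in> ?new f" and g: "g = f(b := x)"
      by auto
    have "g ` B = f ` B" "inj_on g B" "x \<notin> f ` B"
      using f x insert.hyps unfolding g independent_families_def
      by (auto intro: inj_on_fun_updI ac.span_base)
    moreover have "ac.independent (insert x (f ` B))"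
      using f x by (intro ac.independent_insertI) (auto simp: independent_families_def)
    ultimately show "g \<in> ?I (insert b B)"
      using f x insert.hyps unfolding independent_families_def g
      by (auto simp: PiE_def Pi_def extensional_def)
  next
    fix g
    assume g: "g \<in> ?I (insert b B)"
    define f where "f = g(b := undefined)"
    have im: "f ` B = g ` B" and inj: "inj_on f B \<longleftrightarrow> inj_on g B"
      using insert.hyps unfolding f_def by (auto simp: inj_on_def)
    have "inj_on g B" "g b \<notin> g ` B" "ac.independent (insert (g b) (g ` B))"
      using g insert.hyps unfolding independent_families_def by auto
    then have "ac.independent (g ` B)" "g b \<notin> ac.span (g ` B)"
      by (simp_all add: ac.independent_insert)
    moreover have "f \<in> B \<rightarrow>\<^sub>E GF_ext m" "g b \<in> GF_ext m"
      using g insert.hyps unfolding independent_families_def f_def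
      by (auto simp: PiE_def Pi_def extensional_def)
    ultimately have "f \<in> ?I B" "g b \<in> ?new f"
      using \<open>inj_on g B\<close> by (simp_all add: independent_families_def im inj)
    moreover have "g = ?ext (f, g b)"
      by (simp add: f_def)
    ultimately show "g \<in> ?ext ` Sigma (?I B) ?new"
      by blast
  qed
  ultimately have "card (?I (insert b B)) = card (Sigma (?I B) ?new)"
    using card_image by fastforce
  also have "\<dots> = (\<Sum>f\<in>?I B. card (?new f))"
    using fin finite_GF_ext[OF assms(2)] by (intro card_SigmaI) auto
  finally show ?case
    using insert new by (simp add: q_falling_Suc)
qed

text \<open>
  A functional prescribed on an independent set extends to the whole closure, which gives the
  dual family; conversely, a dual functional isolates a single coefficient of a linear relation.
\<close>

lemma independent_family_iff_dual:
  fixes f :: "'i \<Rightarrow> 'a::finite_field alg_closure"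
  assumes "finite B"
  shows "inj_on f B \<and> ac.independent (f ` B) \<longleftrightarrow>
    (\<forall>b\<in>B. \<exists>\<phi>. ac_linear \<phi> \<and> (\<forall>b'\<in>B. \<phi> (f b') = (if b' = b then 1 else 0)))"
proof
  assume f: "inj_on f B \<and> ac.independent (f ` B)"
  show "\<forall>b\<in>B. \<exists>\<phi>. ac_linear \<phi> \<and> (\<forall>b'\<in>B. \<phi> (f b') = (if b' = b then 1 else 0))"
  proof
    fix b assume "b \<in> B"
    have "\<exists>\<phi>. ac_linear \<phi> \<and> (\<forall>x\<in>f ` B. \<phi> x = (if x = f b then 1 else 0))"
      using f by (intro ac_functional.linear_independent_extend) auto
    then show "\<exists>\<phi>. ac_linear \<phi> \<and> (\<forall>b'\<in>B. \<phi> (f b') = (if b' = b then 1 else 0))"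
      using f \<open>b \<in> B\<close> by (force simp: inj_on_eq_iff)
  qed
next
  assume dual: "\<forall>b\<in>B. \<exists>\<phi>. ac_linear \<phi> \<and> (\<forall>b'\<in>B. \<phi> (f b') = (if b' = b then 1 else 0))"
  have inj: "inj_on f B"
    using dual by (metis inj_onI zero_neq_one)
  have "ac.independent (f ` B)"
  proof (rule ac.independent_if_scalars_zero)
    fix c x
    assume sum: "(\<Sum>x\<in>f ` B. ac_scale (c x) x) = 0" and "x \<in> f ` B"
    then obtain b where b: "b \<in> B" "x = f b"
      by auto
    obtain \<phi> where \<phi>: "ac_linear \<phi>" "\<forall>b'\<in>B. \<phi> (f b') = (if b' = b then 1 else 0)"
      using dual b by blast
    have "0 = \<phi> (\<Sum>b'\<in>B. ac_scale (c (f b')) (f b'))"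
      using sum ac_functional.linear_0[OF \<phi>(1)] by (simp add: sum.reindex[OF inj])
    also have "\<dots> = (\<Sum>b'\<in>B. c (f b') * \<phi> (f b'))"
      by (simp add: ac_functional.linear_sum[OF \<phi>(1)] ac_functional.linear_scale[OF \<phi>(1)])
    also have "\<dots> = c x"
      using \<phi>(2) b assms by (simp add: sum.delta if_distrib[of "\<lambda>t. _ * t"] cong: sum.cong if_cong)
    finally show "c x = 0"
      by simp
  qed (use assms in simp)
  with inj show "inj_on f B \<and> ac.independent (f ` B)" ..
qed


section \<open>The code generated by the coordinates of a word\<close>

lemma ac_functionals_separate:
  fixes x :: "'a::finite_field alg_closure"
  assumes "x \<noteq> 0"
  shows "\<exists>\<phi>. ac_linear \<phi> \<and> \<phi> x \<noteq> 0"
proof -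
  have "\<exists>\<phi>. ac_linear \<phi> \<and> (\<forall>y\<in>{x}. \<phi> y = 1)"
    using assms by (intro ac_functional.linear_independent_extend) auto
  then show ?thesis
    by auto
qed

text \<open>
  Expanding the entries of \<open>u\<close> over a basis of the extension field gives words over the ground
  field; \<open>coord_space u\<close> is their span. Ranging over all functionals, instead of the coordinates
  for one basis, avoids a choice, and no extension degree has to be mentioned.
\<close>

definition coord_space :: "'a::finite_field alg_closure ^ 'n \<Rightarrow> ('a ^ 'n) set" where
  "coord_space u = {\<chi> i. \<phi> (u $ i) | \<phi>. ac_linear \<phi>}"

lemma coord_spaceI: "ac_linear \<phi> \<Longrightarrow> (\<chi> i. \<phi> (u $ i)) \<in> coord_space u"
  unfolding coord_space_def by blast

definition ac_comb :: "('a::finite_field ^ 'n) set \<Rightarrow> ('a ^ 'n \<Rightarrow> 'a alg_closure) \<Rightarrow> 'a alg_closure ^ 'n"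
  where "ac_comb B f = (\<Sum>b\<in>B. f b *s (\<chi> i. to_ac (b $ i)))"

lemma ac_comb_nth: "ac_comb B f $ i = (\<Sum>b\<in>B. ac_scale (b $ i) (f b))"
  by (simp add: ac_comb_def ac_scale_def mult.commute)

lemma ac_comb_cong: "(\<And>b. b \<in> B \<Longrightarrow> f b = g b) \<Longrightarrow> ac_comb B f = ac_comb B g"
  by (simp add: ac_comb_def)

lemma extension_code_eq: "extension_code m C = ac_comb C ` {f. \<forall>c\<in>C. f c \<in> GF_ext m}"
  by (auto simp: extension_code_def ac_comb_def)

lemma coord_space_subspace: "vec.subspace (coord_space u)"
proof (rule vec.subspaceI)
  have "ac_linear (\<lambda>x. 0)"
    by (rule ac_functional.module_hom_zero)
  then show "0 \<in> coord_space u"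
    unfolding coord_space_def by (force simp: vec_eq_iff)
next
  fix v w
  assume "v \<in> coord_space u" "w \<in> coord_space u"
  then obtain \<phi> \<psi> where \<phi>: "ac_linear \<phi>" "v = (\<chi> i. \<phi> (u $ i))"
    and \<psi>: "ac_linear \<psi>" "w = (\<chi> i. \<psi> (u $ i))"
    by (auto simp: coord_space_def)
  have "ac_linear (\<lambda>x. \<phi> x + \<psi> x)"
    using \<phi>(1) \<psi>(1) by (rule ac_functional.linear_compose_add)
  moreover have "v + w = (\<chi> i. \<phi> (u $ i) + \<psi> (u $ i))"
    by (simp add: \<phi> \<psi> vec_eq_iff)
  ultimately show "v + w \<in> coord_space u"
    using coord_spaceI[of "\<lambda>x. \<phi> x + \<psi> x" u] by simp
next
  fix c v
  assume "v \<in> coord_space u"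
  then obtain \<phi> where \<phi>: "ac_linear \<phi>" "v = (\<chi> i. \<phi> (u $ i))"
    by (auto simp: coord_space_def)
  have "ac_linear (\<lambda>x. c * \<phi> x)"
    using \<phi>(1) by (rule ac_functional.linear_compose_scale_right)
  moreover have "c *s v = (\<chi> i. c * \<phi> (u $ i))"
    by (simp add: \<phi> vec_eq_iff)
  ultimately show "c *s v \<in> coord_space u"
    using coord_spaceI[of "\<lambda>x. c * \<phi> x" u] by simp
qed

lemma Supp_coord_space: "Supp (coord_space u) = {i. u $ i \<noteq> 0}"
proof (intro equalityI subsetI)
  fix i
  assume "i \<in> Supp (coord_space u)"
  then obtain \<phi> where "ac_linear \<phi>" "\<phi> (u $ i) \<noteq> 0"
    by (auto simp: Supp_def coord_space_def)
  then show "i \<in> {i. u $ i \<noteq> 0}"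
    using ac_functional.linear_0[of \<phi>] by auto
next
  fix i
  assume "i \<in> {i. u $ i \<noteq> 0}"
  then obtain \<phi> where "ac_linear \<phi>" "\<phi> (u $ i) \<noteq> 0"
    using ac_functionals_separate by blast
  then show "i \<in> Supp (coord_space u)"
    unfolding Supp_def using coord_spaceI[of \<phi> u] by (auto intro!: bexI[of _ "\<chi> i. \<phi> (u $ i)"])
qed

lemma wt_space_coord_space: "wt_space S (coord_space u) = wt S u"
  unfolding wt_space_def wt_def Supp_coord_space by (rule arg_cong[where f = card]) auto

lemma functional_ac_comb:
  assumes "ac_linear \<phi>"
  shows "(\<chi> i. \<phi> (ac_comb B f $ i)) = (\<Sum>b\<in>B. \<phi> (f b) *s b)"
  unfolding vec_eq_iff ac_comb_nth ac_functional.linear_sum[OF assms]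
    ac_functional.linear_scale[OF assms]
  by (simp add: mult.commute)

lemma coord_space_ac_comb:
  "coord_space (ac_comb B f) = {\<Sum>b\<in>B. \<phi> (f b) *s b | \<phi>. ac_linear \<phi>}"
  unfolding coord_space_def by (intro Collect_cong ex_cong1) (auto simp: functional_ac_comb)

lemma coord_space_subset:
  assumes "vec.subspace C" "u \<in> extension_code m C"
  shows "coord_space u \<subseteq> C"
proof -
  obtain f where u: "u = ac_comb C f"
    using assms(2) by (auto simp: extension_code_eq)
  have "(\<Sum>c\<in>C. \<phi> (f c) *s c) \<in> C" for \<phi>
    using assms(1) by (intro vec.subspace_sum vec.subspace_scale)
  then show ?thesis
    unfolding u coord_space_ac_comb by blast
qed

lemma extension_code_nth:
  fixes u :: "'a::finite_field alg_closure ^ 'n"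
  assumes "u \<in> extension_code m C"
  shows "u $ i \<in> GF_ext m"
proof -
  obtain f where "\<forall>c\<in>C. f c \<in> GF_ext m" and u: "u = ac_comb C f"
    using assms by (auto simp: extension_code_eq)
  then show ?thesis
    unfolding u ac_comb_nth
    by (intro ac.subspace_sum[OF GF_ext_subspace] ac.subspace_scale[OF GF_ext_subspace]) auto
qed

text \<open>
  The definition of an extension code has one coefficient per codeword. Here a codeword may
  occur for several indices; its coefficients are added up.
\<close>

lemma sum_in_extension_code:
  fixes C :: "('a::finite_field ^ 'n) set"
  assumes "finite E" and "\<And>e. e \<in> E \<Longrightarrow> x e \<in> GF_ext m" and "\<And>e. e \<in> E \<Longrightarrow> c e \<in> C"
  shows "(\<Sum>e\<in>E. x e *s (\<chi> i. to_ac (c e $ i))) \<in> extension_code m C"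
proof -
  define f where "f b = (\<Sum>e\<in>{e\<in>E. c e = b}. x e)" for b
  have f: "f b \<in> GF_ext m" for b
    using assms(2) unfolding f_def by (intro ac.subspace_sum[OF GF_ext_subspace]) auto
  have "ac_comb C f = (\<Sum>b\<in>C. \<Sum>e\<in>{e\<in>E. c e = b}. x e *s (\<chi> i. to_ac (c e $ i)))"
    unfolding ac_comb_def f_def vec.scale_sum_left by (intro sum.cong) auto
  also have "\<dots> = (\<Sum>e\<in>E. x e *s (\<chi> i. to_ac (c e $ i)))"
    using assms(1,3) by (intro sum.group) auto
  finally show ?thesis
    unfolding extension_code_eq using f by (intro image_eqI[of _ _ f]) auto
qed

lemma extension_code_span:
  fixes B :: "('a::finite_field ^ 'n) set"
  shows "extension_code m (vec.span B) = ac_comb B ` (B \<rightarrow>\<^sub>E GF_ext m)"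
proof (intro equalityI subsetI)
  fix u
  assume "u \<in> extension_code m (vec.span B)"
  then obtain f where f: "\<forall>c\<in>vec.span B. f c \<in> GF_ext m" and u: "u = ac_comb (vec.span B) f"
    by (auto simp: extension_code_eq)
  have "\<forall>c\<in>vec.span B. \<exists>r. c = (\<Sum>b\<in>B. r b *s b)"
    by (auto simp: vec.span_finite)
  then obtain r where r: "\<And>c. c \<in> vec.span B \<Longrightarrow> c = (\<Sum>b\<in>B. r c b *s b)"
    unfolding bchoice_iff by blast
  define g where "g b = (\<Sum>c\<in>vec.span B. ac_scale (r c b) (f c))" for b
  have g: "g b \<in> GF_ext m" for b
    using f unfolding g_def
    by (intro ac.subspace_sum[OF GF_ext_subspace] ac.subspace_scale[OF GF_ext_subspace]) auto
  have "u $ i = ac_comb B g $ i" for i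
  proof -
    have "u $ i = (\<Sum>c\<in>vec.span B. ac_scale (\<Sum>b\<in>B. r c b * b $ i) (f c))"
      unfolding u ac_comb_nth
    proof (intro sum.cong refl)
      fix c
      assume "c \<in> vec.span B"
      then have "c $ i = (\<Sum>b\<in>B. r c b *s b) $ i"
        using r by metis
      then show "ac_scale (c $ i) (f c) = ac_scale (\<Sum>b\<in>B. r c b * b $ i) (f c)"
        by simp
    qed
    also have "\<dots> = (\<Sum>b\<in>B. \<Sum>c\<in>vec.span B. ac_scale (b $ i) (ac_scale (r c b) (f c)))"
      by (subst sum.swap) (simp add: ac.scale_sum_left ac.scale_scale mult.commute)
    also have "\<dots> = ac_comb B g $ i"
      by (simp add: ac_comb_nth g_def ac.scale_sum_right)
    finally show ?thesis .
  qed
  then have "u = ac_comb B (restrict g B)"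
    using ac_comb_cong[of B "restrict g B" g] by (simp add: vec_eq_iff)
  then show "u \<in> ac_comb B ` (B \<rightarrow>\<^sub>E GF_ext m)"
    using g by auto
next
  fix u
  assume "u \<in> ac_comb B ` (B \<rightarrow>\<^sub>E GF_ext m)"
  then obtain f where f: "f \<in> B \<rightarrow>\<^sub>E GF_ext m" "u = ac_comb B f"
    by auto
  have "f b \<in> GF_ext m" if "b \<in> B" for b
    using f(1) that by auto
  then show "u \<in> extension_code m (vec.span B)"
    unfolding f(2) ac_comb_def
    using sum_in_extension_code[of B f m "\<lambda>b. b" "vec.span B"] by (simp add: vec.span_base)
qed

lemma finite_extension_code:
  fixes C :: "('a::finite_field ^ 'n) set"
  assumes "0 < m" "vec.subspace C"
  shows "finite (extension_code m C)"
proof -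
  have "extension_code m C = ac_comb C ` (C \<rightarrow>\<^sub>E GF_ext m)"
    using extension_code_span[of m C] unfolding vec.span_eq_iff[THEN iffD2, OF assms(2)] .
  moreover have "finite (C \<rightarrow>\<^sub>E (GF_ext m :: 'a alg_closure set))"
    using finite_GF_ext[OF assms(1)] by (intro finite_PiE) auto
  ultimately show ?thesis
    by simp
qed

text \<open>
  Expand the entries over a basis \<open>E\<close> of the extension field: if \<open>\<phi>\<^sub>e\<close> reads off the coordinate at
  \<open>e\<close>, then \<open>u = (\<Sum>e\<in>E. e \<phi>\<^sub>e(u))\<close>, and the words \<open>\<phi>\<^sub>e(u)\<close> lie in \<open>coord_space u\<close>.
\<close>

lemma in_extension_code_coord_space:
  fixes u :: "'a::finite_field alg_closure ^ 'n"
  assumes "0 < m" and u: "\<And>i. u $ i \<in> GF_ext m"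
  shows "u \<in> extension_code m (coord_space u)"
proof -
  obtain E :: "'a alg_closure set" where E: "E \<subseteq> GF_ext m" "ac.independent E" "GF_ext m \<subseteq> ac.span E"
      "card E = ac.dim (GF_ext m :: 'a alg_closure set)"
    by (rule ac.basis_exists)
  have fin: "finite E"
    using E(1) finite_GF_ext[OF assms(1)] by (rule finite_subset)
  have "\<forall>e\<in>E. \<exists>\<phi>. ac_linear \<phi> \<and> (\<forall>e'\<in>E. \<phi> e' = (if e' = e then 1 else 0))"
    using independent_family_iff_dual[OF fin, of "\<lambda>e. e"] E(2) by simp
  then obtain \<phi> where lin: "\<And>e. e \<in> E \<Longrightarrow> ac_linear (\<phi> e)"
    and dual: "\<And>e e'. e \<in> E \<Longrightarrow> e' \<in> E \<Longrightarrow> \<phi> e e' = (if e' = e then 1 else 0)"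
    unfolding bchoice_iff by blast
  have expand: "x = (\<Sum>e\<in>E. ac_scale (\<phi> e x) e)" if "x \<in> GF_ext m" for x
  proof -
    have "x \<in> range (\<lambda>r. \<Sum>e\<in>E. ac_scale (r e) e)"
      using that E(3) unfolding ac.span_finite[OF fin] by blast
    then obtain r where r: "x = (\<Sum>e\<in>E. ac_scale (r e) e)"
      by blast
    have "\<phi> e x = r e" if "e \<in> E" for e
    proof -
      have "\<phi> e x = (\<Sum>e'\<in>E. r e' * \<phi> e e')"
        unfolding r ac_functional.linear_sum[OF lin[OF that]] ac_functional.linear_scale[OF lin[OF that]] ..
      also have "\<dots> = (\<Sum>e'\<in>E. if e' = e then r e' else 0)"
        using dual[OF that] by (intro sum.cong) auto
      finally show ?thesis
        using that fin by simp
    qed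
    then show ?thesis
      using r by simp
  qed
  have "(\<Sum>e\<in>E. e *s (\<chi> i. to_ac ((\<chi> i. \<phi> e (u $ i)) $ i))) \<in> extension_code m (coord_space u)"
    using fin E(1) lin by (intro sum_in_extension_code) (auto intro: coord_spaceI)
  also have "(\<Sum>e\<in>E. e *s (\<chi> i. to_ac ((\<chi> i. \<phi> e (u $ i)) $ i))) = u"
    using expand[OF u] by (simp add: vec_eq_iff ac_scale_def mult.commute)
  finally show ?thesis .
qed

lemma extension_code_mono:
  assumes "C \<subseteq> D"
  shows "extension_code m C \<subseteq> extension_code m D"
proof
  fix u
  assume "u \<in> extension_code m C"
  then obtain f where f: "\<forall>c\<in>C. f c \<in> GF_ext m" "u = ac_comb C f"
    by (auto simp: extension_code_eq)
  show "u \<in> extension_code m D"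
    unfolding f(2) ac_comb_def
    using sum_in_extension_code[of C f m "\<lambda>c. c" D] f(1) assms by auto
qed

text \<open>
  Independence over the ground field survives the extension of scalars, because every functional
  turns a relation over the extension field into one over the ground field.
\<close>

lemma inj_on_ac_comb:
  fixes B :: "('a::finite_field ^ 'n) set"
  assumes "vec.independent B"
  shows "inj_on (ac_comb B) (B \<rightarrow>\<^sub>E Y)"
proof (rule inj_onI)
  fix f g
  assume f: "f \<in> B \<rightarrow>\<^sub>E Y" and g: "g \<in> B \<rightarrow>\<^sub>E Y" and eq: "ac_comb B f = ac_comb B g"
  show "f = g"
  proof (rule PiE_ext[OF f g], rule ccontr)
    fix b
    assume b: "b \<in> B" and "f b \<noteq> g b"
    then obtain \<phi> where \<phi>: "ac_linear \<phi>" "\<phi> (f b - g b) \<noteq> 0"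
      using ac_functionals_separate[of "f b - g b"] by auto
    have "(\<Sum>b\<in>B. \<phi> (f b) *s b) = (\<Sum>b\<in>B. \<phi> (g b) *s b)"
      using functional_ac_comb[OF \<phi>(1), of B f] functional_ac_comb[OF \<phi>(1), of B g] eq by simp
    then have "(\<Sum>b\<in>B. (\<phi> (f b) - \<phi> (g b)) *s b) = 0"
      by (simp add: vec.scale_left_diff_distrib sum_subtractf)
    then have "\<phi> (f b) - \<phi> (g b) = 0"
      by (rule vec.independentD[OF assms _ subset_refl _ b, rotated]) simp
    then show False
      using \<phi> ac_functional.linear_diff[OF \<phi>(1)] by simp
  qed
qed

text \<open>
  A basis vector \<open>b\<close> lies in \<open>coord_space (ac_comb B f)\<close> iff some functional is \<open>1\<close> at \<open>f b\<close> and \<open>0\<close>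
  at the other coefficients, so all of \<open>B\<close> does iff the coefficients have a dual family.
\<close>

lemma coord_space_ac_comb_eq_span_iff:
  fixes B :: "('a::finite_field ^ 'n) set"
  assumes "vec.independent B"
  shows "coord_space (ac_comb B f) = vec.span B \<longleftrightarrow> inj_on f B \<and> ac.independent (f ` B)"
proof -
  have unit: "(\<Sum>b'\<in>B. (if b' = b then 1 else 0) *s b') = b" if "b \<in> B" for b
  proof -
    have "(\<Sum>b'\<in>B. (if b' = b then 1 else 0) *s b') = (\<Sum>b'\<in>B. if b' = b then b' else 0)"
      by (intro sum.cong) auto
    then show ?thesis
      using that by simp
  qed
  have "b \<in> coord_space (ac_comb B f) \<longleftrightarrow>
      (\<exists>\<phi>. ac_linear \<phi> \<and> (\<forall>b'\<in>B. \<phi> (f b') = (if b' = b then 1 else 0)))" if b: "b \<in> B" for b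
  proof
    assume "b \<in> coord_space (ac_comb B f)"
    then obtain \<phi> where \<phi>: "ac_linear \<phi>" "b = (\<Sum>b'\<in>B. \<phi> (f b') *s b')"
      by (auto simp: coord_space_ac_comb)
    have "(\<Sum>b'\<in>B. (\<phi> (f b') - (if b' = b then 1 else 0)) *s b') = 0"
      using \<phi>(2) unit[OF b] by (simp add: vec.scale_left_diff_distrib sum_subtractf)
    then have "\<phi> (f b') - (if b' = b then 1 else 0) = 0" if "b' \<in> B" for b'
      by (rule vec.independentD[OF assms _ subset_refl _ that, rotated]) simp
    then show "\<exists>\<phi>. ac_linear \<phi> \<and> (\<forall>b'\<in>B. \<phi> (f b') = (if b' = b then 1 else 0))"
      using \<phi>(1) by (intro exI[of _ \<phi>]) simp
  next
    assume "\<exists>\<phi>. ac_linear \<phi> \<and> (\<forall>b'\<in>B. \<phi> (f b') = (if b' = b then 1 else 0))"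
    then obtain \<phi> where \<phi>: "ac_linear \<phi>" "\<forall>b'\<in>B. \<phi> (f b') = (if b' = b then 1 else 0)"
      by blast
    have "(\<Sum>b'\<in>B. \<phi> (f b') *s b') = (\<Sum>b'\<in>B. (if b' = b then 1 else 0) *s b')"
      using \<phi>(2) by (intro sum.cong) auto
    then have "b = (\<Sum>b'\<in>B. \<phi> (f b') *s b')"
      using unit[OF b] by simp
    then show "b \<in> coord_space (ac_comb B f)"
      using \<phi>(1) unfolding coord_space_ac_comb by blast
  qed
  moreover have "coord_space (ac_comb B f) = vec.span B \<longleftrightarrow> B \<subseteq> coord_space (ac_comb B f)"
  proof
    assume "B \<subseteq> coord_space (ac_comb B f)"
    then have "vec.span B \<subseteq> coord_space (ac_comb B f)"
      using coord_space_subspace by (rule vec.span_minimal)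
    moreover have "coord_space (ac_comb B f) \<subseteq> vec.span B"
      unfolding coord_space_ac_comb by (auto intro: vec.span_sum vec.span_scale vec.span_base)
    ultimately show "coord_space (ac_comb B f) = vec.span B"
      by simp
  qed (auto intro: vec.span_base)
  ultimately show ?thesis
    unfolding independent_family_iff_dual[OF finite[of B]] by blast
qed

text \<open>
  Over a basis \<open>B\<close> of \<open>D\<close>, the words with \<open>coord_space u = D\<close> are the combinations of \<open>B\<close> whose
  coefficients are linearly independent over the ground field.
\<close>

lemma card_coord_space_eq:
  fixes D :: "('a::finite_field ^ 'n) set"
  assumes "0 < m" "vec.subspace D"
  shows "of_nat (card {u \<in> extension_code m D. coord_space u = D}) = q_falling CARD('a) m (vec.dim D)"
proof -
  obtain B where B: "B \<subseteq> D" "vec.independent B" "D \<subseteq> vec.span B" "card B = vec.dim D"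
    by (rule vec.basis_exists)
  have D: "D = vec.span B"
    using B assms(2) vec.span_minimal by blast
  have "{u \<in> extension_code m D. coord_space u = D} = ac_comb B ` independent_families m B"
    unfolding D extension_code_span independent_families_def
    using coord_space_ac_comb_eq_span_iff[OF B(2)] by auto
  moreover have "inj_on (ac_comb B) (independent_families m B)"
    using inj_on_ac_comb[OF B(2)] by (rule inj_on_subset) (auto simp: independent_families_def)
  ultimately show ?thesis
    using card_independent_families[of B m] assms(1) B(4) by (simp add: card_image)
qed


section \<open>Extended Jacobi polynomials in terms of the higher ones\<close>

text \<open>
  Sort the words by \<open>coord_space\<close>, which preserves both weights: each code \<open>D\<close> of dimension \<open>s\<close>
  contained in \<open>C\<close> arises from \<open>q_falling q m s\<close> words.
\<close>

lemma A_ext_eq_sum_A_higher: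
  fixes C :: "('a::finite_field ^ 'n) set"
  assumes "0 < m" "vec.subspace C"
  shows "of_nat (A_ext m C T i j) = (\<Sum>s\<le>m. q_falling CARD('a) m s * of_nat (A_higher s C T i j))"
proof -
  define U where "U = {u \<in> extension_code m C. wt (- T) u = i \<and> wt T u = j}"
  define S where "S = {D. vec.subspace D \<and> D \<subseteq> C \<and> wt_space (- T) D = i \<and> wt_space T D = j}"
  let ?f = "q_falling CARD('a) m"
  have fiber: "{u \<in> U. coord_space u = D} = {u \<in> extension_code m D. coord_space u = D}" if "D \<in> S" for D
  proof -
    have "u \<in> extension_code m C \<longleftrightarrow> u \<in> extension_code m D" if "coord_space u = D" for u
      using that \<open>D \<in> S\<close> in_extension_code_coord_space[OF assms(1), of u] extension_code_nth[of u m C]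
        extension_code_mono[of D C m] by (auto simp: S_def)
    moreover have "wt (- T) u = i" "wt T u = j" if "coord_space u = D" for u
      using that \<open>D \<in> S\<close> wt_space_coord_space[of _ u] by (auto simp: S_def)
    ultimately show ?thesis
      unfolding U_def by blast
  qed
  have "coord_space ` U \<subseteq> S"
    using coord_space_subset[OF assms(2)]
    by (auto simp: U_def S_def coord_space_subspace wt_space_coord_space)
  moreover have "finite U"
    using finite_extension_code[OF assms] by (simp add: U_def)
  ultimately have "card U = (\<Sum>D\<in>S. card {u \<in> U. coord_space u = D})"
    using sum.group[of U S coord_space "\<lambda>_. 1 :: nat"] by simp
  also have "\<dots> = (\<Sum>D\<in>S. card {u \<in> extension_code m D. coord_space u = D})"
    using fiber by simp
  also have "rat_of_nat \<dots> = (\<Sum>D\<in>S. ?f (vec.dim D))"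
    unfolding of_nat_sum using assms(1)
    by (intro sum.cong refl card_coord_space_eq) (auto simp: S_def)
  \<comment> \<open>A field of degree \<open>m\<close> has no more than \<open>m\<close> independent elements, so larger \<open>D\<close> do not occur.\<close>
  also have "\<dots> = (\<Sum>D\<in>{D\<in>S. vec.dim D \<le> m}. ?f (vec.dim D))"
    by (intro sum.mono_neutral_right) (auto simp: q_falling_eq_0 intro!: leI)
  also have "\<dots> = (\<Sum>s\<le>m. \<Sum>D\<in>{D\<in>{D\<in>S. vec.dim D \<le> m}. vec.dim D = s}. ?f (vec.dim D))"
    by (intro sum.group[symmetric]) auto
  also have "\<dots> = (\<Sum>s\<le>m. ?f s * of_nat (A_higher s C T i j))"
  proof (intro sum.cong refl)
    fix s
    assume "s \<in> {..m}"
    then have "{D\<in>{D\<in>S. vec.dim D \<le> m}. vec.dim D = s} =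
        {D \<in> subcodes s C. wt_space (- T) D = i \<and> wt_space T D = j}"
      by (auto simp: S_def subcodes_def)
    then show "(\<Sum>D\<in>{D\<in>{D\<in>S. vec.dim D \<le> m}. vec.dim D = s}. ?f (vec.dim D)) =
        ?f s * of_nat (A_higher s C T i j)"
      by (simp add: A_higher_def subcodes_def)
  qed
  finally show ?thesis
    by (simp add: A_ext_def U_def)
qed

lemma A_higher_0:
  fixes C :: "('a::finite_field ^ 'n) set"
  assumes "vec.subspace C"
  shows "A_higher 0 C T i j = (if i = 0 \<and> j = 0 then 1 else 0)"
proof -
  have "subcodes 0 C = {{0}}"
    using assms vec.subspace_0 by (auto simp: subcodes_def vec.dim_eq_0)
  moreover have "wt_space S {0 :: 'a ^ 'n} = 0" for S
    by (simp add: wt_space_def Supp_def)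
  ultimately have "{D \<in> subcodes 0 C. wt_space (- T) D = i \<and> wt_space T D = j} =
      {D \<in> {{0}}. 0 = i \<and> 0 = j}"
    by (intro Collect_cong) (metis singletonD)
  then show ?thesis
    by (auto simp: A_higher_def)
qed

lemma Const_0 [simp]: "Const 0 = 0"
  by (simp add: Const_def)

lemma Const_1 [simp]: "Const 1 = 1"
  by (simp add: Const_def)

lemma Const_add: "Const (a + b) = Const a + Const b"
  by (simp add: Const_def single_add)

lemma Const_mult: "Const (a * b) = Const a * Const b"
  by (simp add: Const_def mult_single)

lemma Const_of_nat: "Const (of_nat n) = of_nat n"
  by (induction n) (simp_all add: Const_add)

lemma Const_sum: "Const (\<Sum>x\<in>A. f x) = (\<Sum>x\<in>A. Const (f x))"
  by (induction A rule: infinite_finite_induct) (simp_all add: Const_add)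

text \<open>
  For exponent \<open>0\<close>, which has no extension field behind it, both sides reduce to the term of the
  zero code. This makes the triangular system uniform in the exponent, as the inversion requires.
\<close>

lemma ext_jacobi_eq_sum_higher_jacobi:
  fixes C :: "('a::finite_field ^ 'n) set"
  assumes "vec.subspace C"
  shows "ext_jacobi m C T = (\<Sum>s\<le>m. Const (q_falling CARD('a) m s) * higher_jacobi s C T)"
proof (cases "m = 0")
  case True
  have "higher_jacobi 0 C T = (\<Sum>i = 0..CARD('n) - card T. \<Sum>j = 0..card T. if j = 0 then
      (if i = 0 then Var var_w ^ card T * Var var_x ^ (CARD('n) - card T) else 0) else 0)"
    unfolding higher_jacobi_def A_higher_0[OF assms] by (intro sum.cong refl) auto
  also have "\<dots> = Var var_w ^ card T * Var var_x ^ (CARD('n) - card T)"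
    by simp
  finally show ?thesis
    using True by (simp add: ext_jacobi_def)
next
  case False
  define mono :: "nat \<Rightarrow> nat \<Rightarrow> jpoly" where "mono i j =
    Var var_w ^ (card T - j) * Var var_z ^ j * Var var_x ^ (CARD('n) - card T - i) * Var var_y ^ i" for i j
  let ?H = "\<lambda>s i j. Const (q_falling CARD('a) m s) * (of_nat (A_higher s C T i j) * mono i j)"
  have coeff: "of_nat (A_ext m C T i j) * mono i j = (\<Sum>s\<le>m. ?H s i j)" for i j
  proof -
    have "of_nat (A_ext m C T i j) = Const (of_nat (A_ext m C T i j))"
      by (simp add: Const_of_nat)
    also have "\<dots> = (\<Sum>s\<le>m. Const (q_falling CARD('a) m s) * of_nat (A_higher s C T i j))"
      using False by (simp add: A_ext_eq_sum_A_higher[OF _ assms] Const_sum Const_mult Const_of_nat)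
    finally show ?thesis
      by (simp add: sum_distrib_right mult.assoc)
  qed
  have "ext_jacobi m C T = (\<Sum>i = 0..CARD('n) - card T. \<Sum>j = 0..card T. \<Sum>s\<le>m. ?H s i j)"
    using False coeff unfolding ext_jacobi_def by (simp add: mono_def mult.assoc)
  also have "\<dots> = (\<Sum>i = 0..CARD('n) - card T. \<Sum>s\<le>m. \<Sum>j = 0..card T. ?H s i j)"
    by (rule sum.cong[OF refl]) (rule sum.swap)
  also have "\<dots> = (\<Sum>s\<le>m. \<Sum>i = 0..CARD('n) - card T. \<Sum>j = 0..card T. ?H s i j)"
    by (rule sum.swap)
  also have "\<dots> = (\<Sum>s\<le>m. Const (q_falling CARD('a) m s) * higher_jacobi s C T)"
    by (simp add: higher_jacobi_def mono_def sum_distrib_left mult.assoc)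
  finally show ?thesis .
qed

theorem theorem4p2:
  fixes C :: "('a::finite_field ^ 'n) set" and T :: "'n set" and q k r :: nat
  assumes "q = CARD('a)"
    and "vec.subspace C" and "vec.dim C = k"
    and "r \<le> k"
  shows "higher_jacobi r C T =
    Const (1 / q_falling q r r) *
      (\<Sum>j = 0..r. Const (q_binomial q r j * (-1) ^ (r - j) * of_nat q ^ ((r - j) choose 2)) *
         ext_jacobi j C T)"
proof -
  let ?H = "\<lambda>s. higher_jacobi s C T" and ?c = "q_Cauchy_coeff q r"
  have q: "2 \<le> q"
    using card_mono[of UNIV "{0, 1 :: 'a}"] assms(1) by simp
  have "(\<Sum>j = 0..r. Const (?c j) * ext_jacobi j C T) =
      (\<Sum>j\<le>r. \<Sum>s\<le>r. Const (?c j * q_falling q j s) * ?H s)"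
    unfolding atLeast0AtMost
  proof (intro sum.cong refl)
    fix j
    assume "j \<in> {..r}"
    then have "ext_jacobi j C T = (\<Sum>s\<le>r. Const (q_falling q j s) * ?H s)"
      unfolding ext_jacobi_eq_sum_higher_jacobi[OF assms(2)] assms(1)
      by (intro sum.mono_neutral_left) (auto simp: q_falling_eq_0)
    then show "Const (?c j) * ext_jacobi j C T = (\<Sum>s\<le>r. Const (?c j * q_falling q j s) * ?H s)"
      by (simp add: sum_distrib_left Const_mult mult.assoc)
  qed
  also have "\<dots> = (\<Sum>s\<le>r. Const (\<Sum>j\<le>r. ?c j * q_falling q j s) * ?H s)"
    by (subst sum.swap) (simp add: Const_sum sum_distrib_right)
  also have "\<dots> = (\<Sum>s\<le>r. if s = r then Const (q_falling q r r) * ?H r else 0)"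
    unfolding q_Cauchy_coeff_orthogonal[OF q] by (intro sum.cong refl) auto
  also have "\<dots> = Const (q_falling q r r) * ?H r"
    by simp
  finally have "Const (1 / q_falling q r r) * (\<Sum>j = 0..r. Const (?c j) * ext_jacobi j C T) =
      Const (1 / q_falling q r r * q_falling q r r) * ?H r"
    by (simp only: Const_mult mult.assoc)
  then show ?thesis
    using q_falling_nonzero[OF q, of r r] by (simp add: q_Cauchy_coeff_def)
qed

end
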